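(* The number of nonequivalent $d$-dimensional threshold matrices of order $n$ is not greater than $n^{nd(d-1)}+1$.
   Context: A $d$-dimensional $(0,1)$-matrix $A$ of order $n$ is an array $(a_\alpha)_{\alpha\in I_n^d}$ with $a_\alpha\in\{0,1\}$, where $I_n^d=\{(\alpha_1,\ldots,\alpha_d):\alpha_i\in\{0,\ldots,n-1\}\}$. A hyperplane is a maximal $(d-1)$-dimensional submatrix obtained by fixing one of the coordinates; the $j$-th hyperplane of direction $i$ is $\Gamma_{i,j}=\{\alpha:\alpha_i=j\}$, so there are $n$ hyperplanes in each of the $d$ directions. Hyperplanes of the same direction are called parallel. Two matrices are equivalent if one can be turned into the other by permutations of parallel hyperplanes and by permutations of directions of hyperplanes (matrix transpositions). A $d$-dimensional $(0,1)$-matrix $A$ of order $n$ is a threshold matrix if there is a $(d\times n)$-table $\Lambda=(\lambda_{i,j})$ of nonnegative weights such that for every index $\alpha$: $a_\alpha=1$ if and only if $\sum_{\Gamma_{i,j}\ni\alpha}\lambda_{i,j}\ge 1$.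
   Formalization: The dimension is assumed to satisfy d ≥ 2; for d = 1 and n ≥ 2 the stated bound n^0 + 1 = 2 is false, since there are n + 1 nonequivalent threshold vectors of length n. *)

theory Defs
  imports Complex_Main "HOL-Library.FuncSet" "HOL-Combinatorics.Permutations"
begin

text \<open>Indices and matrices are extensional functions (undefined outside their domain),
  so that equality of functions is equality of indices and of matrices.\<close>

definition idx_set :: "nat \<Rightarrow> nat \<Rightarrow> (nat \<Rightarrow> nat) set" where
  "idx_set d n = (\<Pi>\<^sub>E i\<in>{..<d}. {..<n})"

definition zero_one_matrices :: "nat \<Rightarrow> nat \<Rightarrow> ((nat \<Rightarrow> nat) \<Rightarrow> nat) set" where
  "zero_one_matrices d n = (\<Pi>\<^sub>E \<alpha>\<in>idx_set d n. {0, 1})"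

definition hyperplane :: "nat \<Rightarrow> nat \<Rightarrow> nat \<Rightarrow> nat \<Rightarrow> (nat \<Rightarrow> nat) set" where
  "hyperplane d n i j = {\<alpha> \<in> idx_set d n. \<alpha> i = j}"

definition threshold_matrices :: "nat \<Rightarrow> nat \<Rightarrow> ((nat \<Rightarrow> nat) \<Rightarrow> nat) set" where
  "threshold_matrices d n = {A \<in> zero_one_matrices d n.
     \<exists>\<Lambda> :: nat \<Rightarrow> nat \<Rightarrow> real.
       (\<forall>i<d. \<forall>j<n. \<Lambda> i j \<ge> 0) \<and>
       (\<forall>\<alpha>\<in>idx_set d n. A \<alpha> = 1 \<longleftrightarrow>
          (\<Sum>(i, j) \<in> {(i, j). i < d \<and> j < n \<and> \<alpha> \<in> hyperplane d n i j}. \<Lambda> i j) \<ge> 1)}"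

definition permute_hyperplanes ::
    "nat \<Rightarrow> nat \<Rightarrow> nat \<Rightarrow> (nat \<Rightarrow> nat) \<Rightarrow> ((nat \<Rightarrow> nat) \<Rightarrow> nat) \<Rightarrow> ((nat \<Rightarrow> nat) \<Rightarrow> nat)" where
  "permute_hyperplanes d n k \<pi> A = (\<lambda>\<alpha>\<in>idx_set d n. A (\<alpha>(k := \<pi> (\<alpha> k))))"

text \<open>A permutation \<open>\<sigma>\<close> of \<open>{..<d}\<close> fixes every \<open>i \<ge> d\<close>, so \<open>\<alpha> \<circ> \<sigma>\<close> is again an index.\<close>

definition permute_directions ::
    "nat \<Rightarrow> nat \<Rightarrow> (nat \<Rightarrow> nat) \<Rightarrow> ((nat \<Rightarrow> nat) \<Rightarrow> nat) \<Rightarrow> ((nat \<Rightarrow> nat) \<Rightarrow> nat)" where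
  "permute_directions d n \<sigma> A = (\<lambda>\<alpha>\<in>idx_set d n. A (\<alpha> \<circ> \<sigma>))"

inductive matrix_step ::
    "nat \<Rightarrow> nat \<Rightarrow> ((nat \<Rightarrow> nat) \<Rightarrow> nat) \<Rightarrow> ((nat \<Rightarrow> nat) \<Rightarrow> nat) \<Rightarrow> bool" for d n where
  hyperplanes: "k < d \<Longrightarrow> \<pi> permutes {..<n} \<Longrightarrow> matrix_step d n A (permute_hyperplanes d n k \<pi> A)"
| directions: "\<sigma> permutes {..<d} \<Longrightarrow> matrix_step d n A (permute_directions d n \<sigma> A)"

definition matrix_equiv :: "nat \<Rightarrow> nat \<Rightarrow> (((nat \<Rightarrow> nat) \<Rightarrow> nat) \<times> ((nat \<Rightarrow> nat) \<Rightarrow> nat)) set" where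
  "matrix_equiv d n = {(A, B). A \<in> zero_one_matrices d n \<and> B \<in> zero_one_matrices d n \<and>
     (matrix_step d n)\<^sup>*\<^sup>* A B}"

lemma finite_idx_set: "finite (idx_set d n)"
  unfolding idx_set_def by (simp add: finite_PiE)

lemma finite_zero_one_matrices: "finite (zero_one_matrices d n)"
  unfolding zero_one_matrices_def by (simp add: finite_PiE finite_idx_set)

lemma finite_threshold_quotient: "finite (threshold_matrices d n // matrix_equiv d n)"
proof -
  have "finite (threshold_matrices d n)"
    by (rule finite_subset[OF _ finite_zero_one_matrices]) (auto simp: threshold_matrices_def)
  then show ?thesis by (simp add: quotient_def)
qed

lemma idx_set_upd:
  assumes "k < d" "\<pi> permutes {..<n}" "\<alpha> \<in> idx_set d n"
  shows "\<alpha>(k := \<pi> (\<alpha> k)) \<in> idx_set d n"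
proof -
  have "\<alpha> k < n" using assms(1,3) by (auto simp: idx_set_def)
  then have "\<pi> (\<alpha> k) < n" using permutes_in_image[OF assms(2)] by auto
  then show ?thesis using assms(1,3) by (auto simp: idx_set_def PiE_def extensional_def)
qed

lemma idx_set_comp:
  assumes "\<sigma> permutes {..<d}" "\<alpha> \<in> idx_set d n"
  shows "\<alpha> \<circ> \<sigma> \<in> idx_set d n"
  using assms permutes_in_image[OF assms(1)] permutes_not_in[OF assms(1)]
  by (auto simp: idx_set_def PiE_def extensional_def Pi_def)

lemma matrix_step_closed:
  assumes "matrix_step d n A B" "A \<in> zero_one_matrices d n"
  shows "B \<in> zero_one_matrices d n"
  using assms
proof cases
  case (hyperplanes k \<pi>)
  have "A (\<alpha>(k := \<pi> (\<alpha> k))) \<in> {0, 1}" if "\<alpha> \<in> idx_set d n" for \<alpha>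
    using idx_set_upd[OF hyperplanes(2,3) that] assms(2)
    unfolding zero_one_matrices_def by (rule PiE_mem[rotated])
  then show ?thesis unfolding hyperplanes(1) zero_one_matrices_def permute_hyperplanes_def
    by (intro PiE_I) auto
next
  case (directions \<sigma>)
  have "A (\<alpha> \<circ> \<sigma>) \<in> {0, 1}" if "\<alpha> \<in> idx_set d n" for \<alpha>
    using idx_set_comp[OF directions(2) that] assms(2)
    unfolding zero_one_matrices_def by (rule PiE_mem[rotated])
  then show ?thesis unfolding directions(1) zero_one_matrices_def permute_directions_def
    by (intro PiE_I) auto
qed

lemma matrix_step_sym:
  assumes "matrix_step d n A B" "A \<in> zero_one_matrices d n"
  shows "matrix_step d n B A"
  using assms(1)
proof cases
  case (hyperplanes k \<pi>)
  have inv: "inv \<pi> permutes {..<n}" by (rule permutes_inv[OF hyperplanes(3)])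
  have "permute_hyperplanes d n k (inv \<pi>) B = A"
  proof
    fix \<alpha>
    show "permute_hyperplanes d n k (inv \<pi>) B \<alpha> = A \<alpha>"
    proof (cases "\<alpha> \<in> idx_set d n")
      case True
      then show ?thesis
        using idx_set_upd[OF hyperplanes(2) inv True] permutes_inverses(1)[OF hyperplanes(3)]
        by (simp add: hyperplanes(1) permute_hyperplanes_def)
    next
      case False
      then show ?thesis using assms(2)
        by (simp add: permute_hyperplanes_def zero_one_matrices_def PiE_def extensional_def)
    qed
  qed
  then show ?thesis using matrix_step.hyperplanes[OF hyperplanes(2) inv, of B] by simp
next
  case (directions \<sigma>)
  have inv: "inv \<sigma> permutes {..<d}" by (rule permutes_inv[OF directions(2)])
  have "permute_directions d n (inv \<sigma>) B = A"
  proof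
    fix \<alpha>
    show "permute_directions d n (inv \<sigma>) B \<alpha> = A \<alpha>"
    proof (cases "\<alpha> \<in> idx_set d n")
      case True
      have "(\<alpha> \<circ> inv \<sigma>) \<circ> \<sigma> = \<alpha>"
        using permutes_inverses(2)[OF directions(2)] by (auto simp: fun_eq_iff)
      then show ?thesis using idx_set_comp[OF inv True] True
        by (simp add: directions(1) permute_directions_def)
    next
      case False
      then show ?thesis using assms(2)
        by (simp add: permute_directions_def zero_one_matrices_def PiE_def extensional_def)
    qed
  qed
  then show ?thesis using matrix_step.directions[OF inv, of n B] by simp
qed

lemma equiv_matrix_equiv: "equiv (zero_one_matrices d n) (matrix_equiv d n)"
proof (rule equivI)
  show "matrix_equiv d n \<subseteq> zero_one_matrices d n \<times> zero_one_matrices d n"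
    by (auto simp: matrix_equiv_def)
  show "refl_on (zero_one_matrices d n) (matrix_equiv d n)"
    by (auto simp: refl_on_def matrix_equiv_def)
  show "trans (matrix_equiv d n)"
    by (auto simp: trans_def matrix_equiv_def)
  have "A \<in> zero_one_matrices d n \<Longrightarrow> B \<in> zero_one_matrices d n \<and> (matrix_step d n)\<^sup>*\<^sup>* B A"
    if "(matrix_step d n)\<^sup>*\<^sup>* A B" for A B
    using that
  proof (induction rule: rtranclp_induct)
    case base
    then show ?case by simp
  next
    case (step B C)
    then show ?case
      by (meson converse_rtranclp_into_rtranclp matrix_step_closed matrix_step_sym)
  qed
  then show "sym (matrix_equiv d n)"
    by (auto simp: sym_def matrix_equiv_def)
qed

lemma sum_hyperplanes_containing:
  fixes \<Lambda> :: "nat \<Rightarrow> nat \<Rightarrow> real"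
  assumes "\<alpha> \<in> idx_set d n"
  shows "(\<Sum>(i, j) \<in> {(i, j). i < d \<and> j < n \<and> \<alpha> \<in> hyperplane d n i j}. \<Lambda> i j)
         = (\<Sum>i<d. \<Lambda> i (\<alpha> i))"
proof -
  have "{(i, j). i < d \<and> j < n \<and> \<alpha> \<in> hyperplane d n i j} = (\<lambda>i. (i, \<alpha> i)) ` {..<d}"
    using assms by (auto simp: hyperplane_def idx_set_def)
  moreover have "inj_on (\<lambda>i. (i, \<alpha> i)) {..<d}" by (auto simp: inj_on_def)
  ultimately show ?thesis by (simp add: sum.reindex)
qed

end

theory Submission
  imports Defs
begin

text \<open>A threshold matrix is determined by its numbers of ones in the hyperplanes (an analogue of
  Chow's theorem): if \<open>A\<close> has weights \<open>\<Lambda>\<close> and \<open>B\<close> has the same hyperplane sums, then the sum of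
  \<open>(A \<alpha> - B \<alpha>) * (\<Lambda>(\<alpha>) - 1)\<close> over all indices vanishes, but all its terms are nonnegative.
  Permuting parallel hyperplanes, a class is determined by the \<open>d\<close> multisets of hyperplane sums,
  each consisting of \<open>n\<close> numbers in \<open>{0..M}\<close> with \<open>M = n ^ (d - 1)\<close>. There are
  \<open>M + n choose n\<close> such multisets, which is at most \<open>M ^ n\<close> except when \<open>n \<le> 1\<close> or
  \<open>d = n = 2\<close>; there the number \<open>2 ^ n ^ d\<close> of all matrices is small enough.\<close>

section \<open>Hyperplane sums determine a threshold matrix\<close>

definition hyp_sum :: "nat \<Rightarrow> nat \<Rightarrow> ((nat \<Rightarrow> nat) \<Rightarrow> nat) \<Rightarrow> nat \<Rightarrow> nat \<Rightarrow> nat" where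
  "hyp_sum d n A i j = (\<Sum>\<alpha>\<in>hyperplane d n i j. A \<alpha>)"

lemma sum_over_hyperplanes:
  fixes f :: "(nat \<Rightarrow> nat) \<Rightarrow> 'a::comm_monoid_add"
  assumes "i < d"
  shows "(\<Sum>\<alpha>\<in>idx_set d n. f \<alpha>) = (\<Sum>j<n. \<Sum>\<alpha>\<in>hyperplane d n i j. f \<alpha>)"
proof -
  have "(\<lambda>\<alpha>. \<alpha> i) ` idx_set d n \<subseteq> {..<n}" using assms by (auto simp: idx_set_def)
  from sum.group[OF finite_idx_set _ this, of f] show ?thesis
    by (simp add: hyperplane_def)
qed

text \<open>The weight \<open>\<Lambda> i (\<alpha> i)\<close> is constant on each hyperplane of
  direction \<open>i\<close>. Hence the total weight of the ones depends on \<open>A\<close> only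
  through its hyperplane sums.\<close>

lemma weighted_sum_hyp_sum:
  fixes \<Lambda> :: "nat \<Rightarrow> nat \<Rightarrow> real"
  shows "(\<Sum>\<alpha>\<in>idx_set d n. real (A \<alpha>) * (\<Sum>i<d. \<Lambda> i (\<alpha> i)))
    = (\<Sum>i<d. \<Sum>j<n. \<Lambda> i j * real (hyp_sum d n A i j))"
proof -
  have "(\<Sum>\<alpha>\<in>idx_set d n. real (A \<alpha>) * (\<Sum>i<d. \<Lambda> i (\<alpha> i)))
      = (\<Sum>i<d. \<Sum>\<alpha>\<in>idx_set d n. real (A \<alpha>) * \<Lambda> i (\<alpha> i))"
    unfolding sum_distrib_left by (rule sum.swap)
  also have "\<dots> = (\<Sum>i<d. \<Sum>j<n. \<Lambda> i j * real (hyp_sum d n A i j))"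
  proof (rule sum.cong[OF refl])
    fix i assume "i \<in> {..<d}"
    then have "(\<Sum>\<alpha>\<in>idx_set d n. real (A \<alpha>) * \<Lambda> i (\<alpha> i))
        = (\<Sum>j<n. \<Sum>\<alpha>\<in>hyperplane d n i j. real (A \<alpha>) * \<Lambda> i (\<alpha> i))"
      by (intro sum_over_hyperplanes) simp
    also have "\<dots> = (\<Sum>j<n. \<Lambda> i j * real (hyp_sum d n A i j))"
      unfolding hyp_sum_def of_nat_sum sum_distrib_left
      by (intro sum.cong refl) (simp add: hyperplane_def)
    finally show "(\<Sum>\<alpha>\<in>idx_set d n. real (A \<alpha>) * \<Lambda> i (\<alpha> i))
        = (\<Sum>j<n. \<Lambda> i j * real (hyp_sum d n A i j))" .
  qed
  finally show ?thesis .
qed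

text \<open>The weights come from \<open>A\<close> alone, and \<open>B\<close> ranges over all
  (0,1)-matrices. So a matrix obtained by permuting hyperplanes can take the place of
  \<open>B\<close> without a proof that it is again a threshold matrix.\<close>

lemma threshold_determined_by_hyp_sum:
  assumes A: "A \<in> threshold_matrices d n" and B: "B \<in> zero_one_matrices d n"
    and "0 < d"
    and eq: "\<And>i j. i < d \<Longrightarrow> j < n \<Longrightarrow> hyp_sum d n A i j = hyp_sum d n B i j"
  shows "A = B"
proof -
  have A01: "A \<in> zero_one_matrices d n" using A by (simp add: threshold_matrices_def)
  obtain \<Lambda> :: "nat \<Rightarrow> nat \<Rightarrow> real" where
    "\<forall>\<alpha>\<in>idx_set d n. A \<alpha> = 1 \<longleftrightarrow>
      (\<Sum>(i, j) \<in> {(i, j). i < d \<and> j < n \<and> \<alpha> \<in> hyperplane d n i j}. \<Lambda> i j) \<ge> 1"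
    using A unfolding threshold_matrices_def by blast
  then have \<Lambda>: "A \<alpha> = 1 \<longleftrightarrow> (\<Sum>i<d. \<Lambda> i (\<alpha> i)) \<ge> 1" if "\<alpha> \<in> idx_set d n" for \<alpha>
    using that by (simp add: sum_hyperplanes_containing)
  have vals: "A \<alpha> = 0 \<or> A \<alpha> = 1" "B \<alpha> = 0 \<or> B \<alpha> = 1" if "\<alpha> \<in> idx_set d n" for \<alpha>
    using PiE_mem[OF A01[unfolded zero_one_matrices_def] that]
      PiE_mem[OF B[unfolded zero_one_matrices_def] that] by auto
  define w where "w \<alpha> = (\<Sum>i<d. \<Lambda> i (\<alpha> i))" for \<alpha>
  have total: "(\<Sum>\<alpha>\<in>idx_set d n. A \<alpha>) = (\<Sum>\<alpha>\<in>idx_set d n. B \<alpha>)"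
    using eq[OF \<open>0 < d\<close>] by (simp add: sum_over_hyperplanes[OF \<open>0 < d\<close>] hyp_sum_def)
  have "(\<Sum>\<alpha>\<in>idx_set d n. real (A \<alpha>) * w \<alpha>) = (\<Sum>\<alpha>\<in>idx_set d n. real (B \<alpha>) * w \<alpha>)"
    unfolding w_def weighted_sum_hyp_sum using eq by (intro sum.cong) auto
  then have "(\<Sum>\<alpha>\<in>idx_set d n. (real (A \<alpha>) - real (B \<alpha>)) * (w \<alpha> - 1)) = 0"
    using arg_cong[OF total, of real] by (simp add: algebra_simps sum.distrib sum_subtractf)
  \<comment> \<open>Both factors are nonnegative if \<open>A \<alpha> = 1\<close> and nonpositive if
    \<open>A \<alpha> = 0\<close>.\<close>
  moreover have "(real (A \<alpha>) - real (B \<alpha>)) * (w \<alpha> - 1) \<ge> 0" if "\<alpha> \<in> idx_set d n" for \<alpha>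
    using vals[OF that] \<Lambda>[OF that] by (auto simp: w_def)
  ultimately have zero: "(real (A \<alpha>) - real (B \<alpha>)) * (w \<alpha> - 1) = 0" if "\<alpha> \<in> idx_set d n" for \<alpha>
    using sum_nonneg_eq_0_iff[OF finite_idx_set] that by (metis (no_types, lifting))
  \<comment> \<open>If \<open>A \<alpha> = 0\<close>, then \<open>w \<alpha> < 1\<close> strictly
    and \<open>B \<alpha> = 0\<close> follows. If \<open>A \<alpha> = 1\<close>, the weight may be
    exactly 1, so a vanishing term gives only this inequality; the equal totals then exclude a
    strict one.\<close>
  have le: "B \<alpha> \<le> A \<alpha>" if "\<alpha> \<in> idx_set d n" for \<alpha>
    using vals[OF that] \<Lambda>[OF that] zero[OF that] by (auto simp: w_def)
  have "A \<alpha> = B \<alpha>" if "\<alpha> \<in> idx_set d n" for \<alpha>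
  proof (rule ccontr)
    assume "A \<alpha> \<noteq> B \<alpha>"
    then have "B \<alpha> < A \<alpha>" using le[OF that] by simp
    then have "(\<Sum>\<alpha>\<in>idx_set d n. B \<alpha>) < (\<Sum>\<alpha>\<in>idx_set d n. A \<alpha>)"
      using le that by (intro sum_strict_mono_ex1) (auto simp: finite_idx_set)
    then show False using total by simp
  qed
  then show ?thesis
    using A01 B unfolding zero_one_matrices_def by (intro PiE_ext) auto
qed

section \<open>Aligning hyperplane sums by permuting parallel hyperplanes\<close>

lemma hyp_sum_permute_hyperplanes:
  assumes k: "k < d" and \<pi>: "\<pi> permutes {..<n}"
  shows "hyp_sum d n (permute_hyperplanes d n k \<pi> A) i j
    = hyp_sum d n A i (if i = k then \<pi> j else j)"
proof -
  have inv: "inv \<pi> permutes {..<n}" by (rule permutes_inv[OF \<pi>])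
  note [simp] = permutes_inverses[OF \<pi>]
  show ?thesis unfolding hyp_sum_def
    \<comment> \<open>This bijection carries hyperplane \<open>j\<close> of direction
      \<open>k\<close> to hyperplane \<open>\<pi> j\<close> and maps every hyperplane of another
      direction onto itself.\<close>
    by (rule sum.reindex_bij_witness[where i = "\<lambda>\<alpha>. \<alpha>(k := inv \<pi> (\<alpha> k))"
          and j = "\<lambda>\<alpha>. \<alpha>(k := \<pi> (\<alpha> k))"])
      (auto simp: hyperplane_def permute_hyperplanes_def idx_set_upd[OF k \<pi>] idx_set_upd[OF k inv])
qed

definition hyp_sum_mset ::
    "nat \<Rightarrow> nat \<Rightarrow> ((nat \<Rightarrow> nat) \<Rightarrow> nat) \<Rightarrow> nat \<Rightarrow> nat multiset" where
  "hyp_sum_mset d n A i = image_mset (hyp_sum d n A i) (mset_set {..<n})"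

text \<open>Directions are treated one at a time: a permutation in direction \<open>k\<close> leaves
  the sums of all other directions unchanged. The last conjunct keeps the multiset hypothesis on
  \<open>A\<close> usable for the directions still to come.\<close>

lemma align_hyp_sums:
  assumes "A \<in> zero_one_matrices d n"
    and eq: "\<And>i. i < d \<Longrightarrow> hyp_sum_mset d n A i = hyp_sum_mset d n B i"
    and "k \<le> d"
  shows "\<exists>A'\<in>zero_one_matrices d n. (matrix_step d n)\<^sup>*\<^sup>* A A' \<and>
    (\<forall>i<k. \<forall>j<n. hyp_sum d n A' i j = hyp_sum d n B i j) \<and>
    (\<forall>i\<ge>k. hyp_sum d n A' i = hyp_sum d n A i)"
  using \<open>k \<le> d\<close>
proof (induction k)
  case 0
  then show ?case using assms(1) by auto
next
  case (Suc k)
  then obtain A' where A': "A' \<in> zero_one_matrices d n" "(matrix_step d n)\<^sup>*\<^sup>* A A'"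
    "\<And>i j. i < k \<Longrightarrow> j < n \<Longrightarrow> hyp_sum d n A' i j = hyp_sum d n B i j"
    "\<And>i. i \<ge> k \<Longrightarrow> hyp_sum d n A' i = hyp_sum d n A i"
    by auto
  have k: "k < d" using Suc.prems by simp
  \<comment> \<open>\<open>B\<close> stands on the left so that the permutation obtained acts on the
    indices of \<open>A\<close>, as in \<open>hyp_sum_permute_hyperplanes\<close>.\<close>
  have "image_mset (hyp_sum d n B k) (mset_set {..<n})
      = image_mset (hyp_sum d n A k) (mset_set {..<n})"
    using eq[OF k] by (simp add: hyp_sum_mset_def)
  then obtain \<pi> where \<pi>: "\<pi> permutes {..<n}"
    "\<forall>j\<in>{..<n}. hyp_sum d n B k j = hyp_sum d n A k (\<pi> j)"
    using image_mset_eq_implies_permutes[OF finite_lessThan] by metis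
  define A'' where "A'' = permute_hyperplanes d n k \<pi> A'"
  have step: "matrix_step d n A' A''"
    unfolding A''_def by (rule matrix_step.hyperplanes[OF k \<pi>(1)])
  have sums: "hyp_sum d n A'' i j = hyp_sum d n A' i (if i = k then \<pi> j else j)" for i j
    unfolding A''_def by (rule hyp_sum_permute_hyperplanes[OF k \<pi>(1)])
  have "A'' \<in> zero_one_matrices d n" by (rule matrix_step_closed[OF step A'(1)])
  moreover have "(matrix_step d n)\<^sup>*\<^sup>* A A''"
    using A'(2) step by (meson rtranclp.rtrancl_into_rtrancl)
  moreover have "hyp_sum d n A'' i j = hyp_sum d n B i j" if "i < Suc k" "j < n" for i j
    using that A'(3)[of i j] A'(4)[of k] \<pi>(2) by (auto simp: sums less_Suc_eq)
  moreover have "hyp_sum d n A'' i = hyp_sum d n A i" if "i \<ge> Suc k" for i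
    using that A'(4)[of i] by (auto simp: sums fun_eq_iff)
  ultimately show ?case by blast
qed

lemma matrix_equiv_if_hyp_sum_mset_eq:
  assumes A: "A \<in> threshold_matrices d n" and B: "B \<in> threshold_matrices d n"
    and "0 < d"
    and eq: "\<And>i. i < d \<Longrightarrow> hyp_sum_mset d n A i = hyp_sum_mset d n B i"
  shows "(A, B) \<in> matrix_equiv d n"
proof -
  have A01: "A \<in> zero_one_matrices d n" using A by (simp add: threshold_matrices_def)
  obtain A' where A': "A' \<in> zero_one_matrices d n" "(matrix_step d n)\<^sup>*\<^sup>* A A'"
    "\<forall>i<d. \<forall>j<n. hyp_sum d n A' i j = hyp_sum d n B i j"
    using align_hyp_sums[OF A01 eq order_refl] by blast
  have "B = A'"
    using threshold_determined_by_hyp_sum[OF B A'(1) \<open>0 < d\<close>] A'(3) by simp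
  then show ?thesis using A01 A' by (simp add: matrix_equiv_def)
qed

section \<open>The range of the hyperplane sums and the number of bounded multisets\<close>

lemma card_hyperplane:
  assumes "i < d" "j < n"
  shows "card (hyperplane d n i j) = n ^ (d - 1)"
proof -
  have "hyperplane d n i j = (\<Pi>\<^sub>E l\<in>{..<d}. if l = i then {j} else {..<n})" (is "_ = ?P")
  proof (rule set_eqI)
    fix \<alpha>
    have "(\<forall>l<d. \<alpha> l < n) \<and> \<alpha> i = j \<longleftrightarrow> (\<forall>l<d. \<alpha> l \<in> (if l = i then {j} else {..<n}))"
      using assms by (metis lessThan_iff singletonD singletonI)
    then show "\<alpha> \<in> hyperplane d n i j \<longleftrightarrow> \<alpha> \<in> ?P"
      unfolding hyperplane_def idx_set_def PiE_iff mem_Collect_eq Ball_def lessThan_iff by blast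
  qed
  also have "card \<dots> = (\<Prod>l<d. if l = i then 1 else n)"
    by (auto simp: card_PiE intro!: prod.cong)
  also have "\<dots> = (\<Prod>l\<in>{..<d} - {i}. n)"
    using assms by (subst prod.remove[of _ i]) auto
  finally show ?thesis using assms by simp
qed

lemma hyp_sum_le:
  assumes A: "A \<in> zero_one_matrices d n" and "i < d" "j < n"
  shows "hyp_sum d n A i j \<le> n ^ (d - 1)"
proof -
  have "hyp_sum d n A i j \<le> (\<Sum>\<alpha>\<in>hyperplane d n i j. 1)"
    unfolding hyp_sum_def
  proof (rule sum_mono)
    fix \<alpha> assume "\<alpha> \<in> hyperplane d n i j"
    then have "\<alpha> \<in> idx_set d n" by (simp add: hyperplane_def)
    then show "A \<alpha> \<le> 1" using PiE_mem[OF A[unfolded zero_one_matrices_def]] by fastforce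
  qed
  then show ?thesis using card_hyperplane[OF assms(2,3)] by simp
qed

text \<open>Pascal's recurrence: a multiset either avoids the largest value \<open>M\<close>, or
  loses one copy of it and becomes a multiset of size \<open>n - 1\<close>. Either way
  \<open>M + n\<close> drops by one.\<close>

lemma card_bounded_multisets:
  fixes M n :: nat
  shows "finite {X. set_mset X \<subseteq> {..M} \<and> size X = n} \<and>
    card {X. set_mset X \<subseteq> {..M} \<and> size X = n} \<le> (M + n) choose n"
proof (induction "M + n" arbitrary: M n)
  case 0
  have "{X. set_mset X \<subseteq> {..0::nat} \<and> size X = 0} = {{#}}" by auto
  then show ?case using 0 by simp
next
  case (Suc s)
  define C where "C M n = {X. set_mset X \<subseteq> {..M} \<and> size X = n}" for M n :: nat
  show ?case
  proof (cases n)
    case 0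
    then have "{X. set_mset X \<subseteq> {..M} \<and> size X = n} = {{#}}" by auto
    then show ?thesis using 0 by simp
  next
    case n: (Suc n')
    have IH2: "finite (C M n')" "card (C M n') \<le> (M + n') choose n'"
      using Suc.hyps(1)[of M n'] Suc.hyps(2) n by (auto simp: C_def)
    show ?thesis
    proof (cases M)
      case 0
      have "X = replicate_mset n 0" if "X \<in> C M n" for X
      proof (rule multiset_eqI)
        fix x show "count X x = count (replicate_mset n 0) x"
          using that 0 set_mset_subset_singletonD[of X 0] by (auto simp: C_def)
      qed
      then have "C M n \<subseteq> {replicate_mset n 0}" by auto
      then have "finite (C M n)" "card (C M n) \<le> 1"
        using card_mono[of "{replicate_mset n 0}"] by (auto dest: finite_subset)
      then show ?thesis using 0 by (simp add: C_def)
    next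
      case M: (Suc M')
      have IH1: "finite (C M' n)" "card (C M' n) \<le> (M' + n) choose n"
        using Suc.hyps(1)[of M' n] Suc.hyps(2) M by (auto simp: C_def)
      have sub: "C M n \<subseteq> C M' n \<union> add_mset M ` C M n'"
      proof
        fix X assume X: "X \<in> C M n"
        show "X \<in> C M' n \<union> add_mset M ` C M n'"
        proof (cases "M \<in># X")
          case True
          then obtain Y where "X = add_mset M Y" by (blast dest: multi_member_split)
          then show ?thesis using X n by (auto simp: C_def)
        next
          case False
          then have "set_mset X \<subseteq> {..M'}"
            using X M by (auto simp: C_def subset_iff) (metis le_SucE)
          then show ?thesis using X by (simp add: C_def)
        qed
      qed
      have fin: "finite (C M' n \<union> add_mset M ` C M n')" using IH1 IH2 by simp
      have "card (C M n) \<le> card (C M' n \<union> add_mset M ` C M n')"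
        by (rule card_mono[OF fin sub])
      also have "\<dots> \<le> card (C M' n) + card (C M n')"
        by (rule order_trans[OF card_Un_le]) (simp add: card_image_le IH2(1))
      also have "\<dots> \<le> ((M' + n) choose n) + ((M + n') choose n')"
        using IH1 IH2 by simp
      also have "\<dots> = (M + n) choose n" using M n by simp
      finally show ?thesis using finite_subset[OF sub fin] by (simp add: C_def)
    qed
  qed
qed

section \<open>Comparing the binomial coefficient with a power\<close>

lemma binomial_le_power_Suc:
  fixes M n :: nat
  assumes "(M + n) choose n \<le> M ^ n" "2 \<le> M" "1 \<le> n"
  shows "(M + Suc n) choose Suc n \<le> M ^ Suc n"
proof -
  \<comment> \<open>The quotient of consecutive coefficients is
    \<open>(M + n + 1) / (n + 1)\<close>. It is at most \<open>M\<close>, because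
    \<open>n * M \<ge> 2 * n \<ge> n + 1\<close>.\<close>
  have "Suc n * ((M + Suc n) choose Suc n) = (M + Suc n) * ((M + n) choose n)"
    using Suc_times_binomial_eq[of "M + n" n] by (simp add: mult.commute)
  also have "\<dots> \<le> (Suc n * M) * M ^ n"
  proof (rule mult_mono)
    have "n * 2 \<le> n * M" using assms(2) by (rule mult_le_mono2)
    then show "M + Suc n \<le> Suc n * M" using assms(3) unfolding mult_Suc by linarith
  qed (use assms(1) in auto)
  finally show ?thesis by (simp add: mult.assoc del: mult_Suc)
qed

text \<open>Induction on \<open>n\<close> from 2 if \<open>M \<ge> 4\<close>. For
  \<open>M = 3\<close> it must start at 3, since 5 choose 2 is 10 > 9, whereas 6 choose 3 is 20
  \<le> 27.\<close>

lemma binomial_le_power: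
  fixes M n :: nat
  assumes "4 \<le> M \<and> 2 \<le> n \<or> 3 \<le> M \<and> 3 \<le> n"
  shows "(M + n) choose n \<le> M ^ n"
proof -
  have two: "(M + 2) choose 2 \<le> M ^ 2" if "4 \<le> M"
  proof -
    have "4 * M \<le> M * M" using that by (rule mult_le_mono1)
    moreover have "(M + 2) * (M + 1) = M * M + 3 * M + 2" by (simp add: algebra_simps)
    ultimately have "(M + 2) * (M + 1) \<le> 2 * (M * M)" using that by linarith
    then show ?thesis by (simp add: choose_two power2_eq_square)
  qed
  have three: "(M + 3) choose 3 \<le> M ^ 3" if "3 \<le> M"
  proof (cases "M = 3")
    case True
    then show ?thesis by (simp add: numeral_eq_Suc)
  next
    case False
    then have "4 \<le> M" using that by simp
    then have "(M + Suc 2) choose Suc 2 \<le> M ^ Suc 2"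
      by (intro binomial_le_power_Suc two) simp_all
    moreover have "Suc 2 = 3" by simp
    ultimately show ?thesis by (simp only:)
  qed
  show ?thesis
  proof (cases "4 \<le> M")
    case True
    have "2 \<le> n" using assms by (auto simp: power_0_left)
    then show ?thesis
      by (induction n rule: dec_induct) (use True two binomial_le_power_Suc in auto)
  next
    case False
    then have "3 \<le> n" "3 \<le> M" using assms by (auto simp: power_0_left)
    then show ?thesis
      by (induction n rule: dec_induct) (use three binomial_le_power_Suc in auto)
  qed
qed

section \<open>Counting equivalence classes\<close>

lemma card_quotient_le:
  assumes "equiv S R" "T \<subseteq> S" "finite F" "f ` T \<subseteq> F"
    and "\<And>x y. x \<in> T \<Longrightarrow> y \<in> T \<Longrightarrow> f x = f y \<Longrightarrow> (x, y) \<in> R"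
  shows "card (T // R) \<le> card F"
proof -
  \<comment> \<open>\<open>g\<close> sends a value of \<open>f\<close> to the class of one chosen
    preimage. Elements of \<open>T\<close> with equal values are equivalent, so \<open>g\<close>
    reaches every class.\<close>
  define g where "g = (\<lambda>v. R `` {SOME x. x \<in> T \<and> f x = v})"
  have "T // R \<subseteq> g ` (f ` T)"
  proof
    fix X assume "X \<in> T // R"
    then obtain x where x: "x \<in> T" "X = R `` {x}" by (auto simp: quotient_def)
    define y where "y = (SOME y. y \<in> T \<and> f y = f x)"
    have "y \<in> T \<and> f y = f x" unfolding y_def by (rule someI[of _ x]) (simp add: x)
    then have "(x, y) \<in> R" using assms(5)[of x y] x(1) by simp
    then have "X = g (f x)" using equiv_class_eq[OF assms(1)] x(2) by (simp add: g_def y_def)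
    then show "X \<in> g ` (f ` T)" using x(1) by simp
  qed
  moreover have fin: "finite (f ` T)" using assms(3,4) by (rule finite_subset[rotated])
  ultimately have "card (T // R) \<le> card (f ` T)"
    by (meson card_image_le card_mono finite_imageI order_trans)
  also have "\<dots> \<le> card F" using assms(3,4) by (rule card_mono)
  finally show ?thesis .
qed

lemma threshold_subset: "threshold_matrices d n \<subseteq> zero_one_matrices d n"
  by (auto simp: threshold_matrices_def)

text \<open>The multisets form a family ordered by direction. A transposition may change this family
  within a class, so a class may be counted more than once, which is harmless for an upper
  bound.\<close>

lemma card_threshold_quotient_le_binomial:
  assumes "0 < d"
  shows "card (threshold_matrices d n // matrix_equiv d n) \<le> ((n ^ (d - 1) + n) choose n) ^ d"
proof -
  define C where "C = {X. set_mset X \<subseteq> {..n ^ (d - 1)} \<and> size X = n}"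
  have C: "finite C" "card C \<le> (n ^ (d - 1) + n) choose n"
    unfolding C_def using card_bounded_multisets by auto
  have "card (threshold_matrices d n // matrix_equiv d n) \<le> card ({..<d} \<rightarrow>\<^sub>E C)"
  proof (rule card_quotient_le[OF equiv_matrix_equiv threshold_subset,
        where f = "\<lambda>A. \<lambda>i\<in>{..<d}. hyp_sum_mset d n A i"])
    show "finite ({..<d} \<rightarrow>\<^sub>E C)" using C by (simp add: finite_PiE)
    have "hyp_sum_mset d n A i \<in> C" if "A \<in> threshold_matrices d n" "i < d" for A i
      using hyp_sum_le[of A d n i] that threshold_subset by (auto simp: C_def hyp_sum_mset_def)
    then show "(\<lambda>A. \<lambda>i\<in>{..<d}. hyp_sum_mset d n A i) ` threshold_matrices d n
        \<subseteq> {..<d} \<rightarrow>\<^sub>E C" by (auto split: if_splits)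
    fix A B
    assume AB: "A \<in> threshold_matrices d n" "B \<in> threshold_matrices d n"
      and eq: "(\<lambda>i\<in>{..<d}. hyp_sum_mset d n A i) = (\<lambda>i\<in>{..<d}. hyp_sum_mset d n B i)"
    have "hyp_sum_mset d n A i = hyp_sum_mset d n B i" if "i < d" for i
      using fun_cong[OF eq, of i] that by simp
    then show "(A, B) \<in> matrix_equiv d n"
      by (rule matrix_equiv_if_hyp_sum_mset_eq[OF AB assms])
  qed
  also have "\<dots> = card C ^ d" by (simp add: card_PiE)
  also have "\<dots> \<le> ((n ^ (d - 1) + n) choose n) ^ d" using C(2) by (rule power_mono) simp
  finally show ?thesis .
qed

lemma card_threshold_quotient_le_all:
  "card (threshold_matrices d n // matrix_equiv d n) \<le> 2 ^ (n ^ d)"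
proof -
  have "card (threshold_matrices d n // matrix_equiv d n) \<le> card (zero_one_matrices d n)"
  proof (rule card_quotient_le[OF equiv_matrix_equiv threshold_subset finite_zero_one_matrices,
        where f = id])
    show "id ` threshold_matrices d n \<subseteq> zero_one_matrices d n"
      using threshold_subset by simp
    show "(A, B) \<in> matrix_equiv d n" if "A \<in> threshold_matrices d n" "id A = id B" for A B
      using that subsetD[OF threshold_subset that(1)] by (simp add: matrix_equiv_def)
  qed
  also have "\<dots> = 2 ^ (n ^ d)"
  proof -
    have "card (idx_set d n) = n ^ d" by (simp add: idx_set_def card_PiE)
    moreover have "card {0, 1::nat} = 2" by simp
    ultimately show ?thesis
      by (simp only: zero_one_matrices_def card_PiE[OF finite_idx_set] prod_constant)
  qed
  finally show ?thesis .
qed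

theorem theorem8:
  fixes d n :: nat
  assumes "d \<ge> 2"
  shows "card (threshold_matrices d n // matrix_equiv d n) \<le> n ^ (n * d * (d - 1)) + 1"
proof -
  \<comment> \<open>With \<open>M = n ^ (d - 1)\<close>: \<open>n \<ge> 3\<close> gives
    \<open>M \<ge> n \<ge> 3\<close>, and \<open>n = 2\<close> with \<open>d \<ge> 3\<close> gives
    \<open>M \<ge> 4\<close>.\<close>
  consider (small) "n \<le> 1" | (two) "n = 2" "d = 2"
    | (large) "4 \<le> n ^ (d - 1) \<and> 2 \<le> n \<or> 3 \<le> n ^ (d - 1) \<and> 3 \<le> n"
  proof -
    have "n ^ 1 \<le> n ^ (d - 1)" if "3 \<le> n"
      using that assms by (intro power_increasing) auto
    moreover have "2 ^ 2 \<le> (2::nat) ^ (d - 1)" if "d \<noteq> 2"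
      using that assms by (intro power_increasing) auto
    ultimately show thesis using that by (cases "n \<ge> 3"; cases "n = 2"; cases "d = 2") auto
  qed
  then show ?thesis
  proof cases
    case small
    \<comment> \<open>For \<open>n = 0\<close> there is one matrix. For \<open>n = 1\<close> there
      are two, and the bound \<open>1 + 1\<close> holds only thanks to the added 1.\<close>
    then have "n = 0 \<or> n = 1" by auto
    then show ?thesis using card_threshold_quotient_le_all[of d n] assms by (auto simp: power_0_left)
  next
    case two
    \<comment> \<open>All 16 matrices are within the bound \<open>2 ^ 4 + 1 = 17\<close>, while the
      multiset count would give \<open>6 ^ 2 = 36\<close>.\<close>
    then show ?thesis using card_threshold_quotient_le_all[of 2 2] by simp
  next
    case large
    have "card (threshold_matrices d n // matrix_equiv d n) \<le> ((n ^ (d - 1) + n) choose n) ^ d"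
      using card_threshold_quotient_le_binomial assms by simp
    also have "\<dots> \<le> ((n ^ (d - 1)) ^ n) ^ d"
      using binomial_le_power[OF large] by (rule power_mono) simp
    also have "\<dots> = n ^ (n * d * (d - 1))"
      by (simp add: power_mult[symmetric] mult_ac)
    finally show ?thesis by simp
  qed
qed

end
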